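(* Let $X$ be a separable Banach space. Assume that at least one of the following conditions holds: (1) $X$ has a $K$-unconditional basis for some $1\le K<2$; (2) $B_X$ is the closed convex hull of a set of uniformly strongly exposed points. Then $X^*$ has the uniform ball-covering property (UBCP).
   Context: All Banach spaces are real. $B_X$, $S_X$ denote the closed unit ball and the unit sphere; $B(x,r)$ is the open ball with center $x$ and radius $r>0$. A Schauder basis $(e_n)$ of $X$ is $K$-unconditional ($K\ge1$) if $\left\|\sum_n a_ne_n\right\|\le K\left\|\sum_n b_ne_n\right\|$ for all finitely supported scalar sequences $(a_n),(b_n)$ with $|a_n|\le|b_n|$ for every $n$. A subset $U\subset S_X$ is a set of uniformly strongly exposed points if there is a family $\{f_u\}_{u\in U}\subset X^*$ with $\|f_u\|=f_u(u)=1$ for every $u\in U$, such that for every $\varepsilon>0$ there is $\delta>0$ such that whenever $z\in B_X$ and $u\in U$ satisfy $f_u(z)>1-\delta$, then $\|u-z\|<\varepsilon$. A Banach space $Z$ has the UBCP if there are $r,\alpha>0$ and a countable collection of open balls $\{B(z_n,r_n)\}$ with $S_Z\subset\bigcup_nB(z_n,r_n)$, $\|z_n\|\ge r_n+\alpha$ for all $n$, and $\sup_n r_n\le r$. *)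

theory Defs
  imports "HOL-Analysis.Analysis"
begin

text \<open>The basis is indexed by \<open>{n. enat n < N}\<close>: \<open>N = \<infinity>\<close> gives an infinite basis
  \<open>e 0, e 1, \<dots>\<close>, and \<open>N = enat d\<close> a basis \<open>e 0, \<dots>, e (d - 1)\<close> of a \<open>d\<close>-dimensional space.
  Values of \<open>e\<close> outside the index range are irrelevant.\<close>

definition schauder_basis :: "enat \<Rightarrow> (nat \<Rightarrow> 'a::banach) \<Rightarrow> bool" where
  "schauder_basis N e \<longleftrightarrow>
     (\<forall>x. \<exists>!a :: nat \<Rightarrow> real. (\<forall>n. N \<le> enat n \<longrightarrow> a n = 0) \<and> (\<lambda>n. a n *\<^sub>R e n) sums x)"

text \<open>A pair of finitely supported scalar sequences is given by its restriction to a common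
  finite set \<open>F\<close> of indices containing both supports.\<close>

definition unconditional_basis :: "real \<Rightarrow> enat \<Rightarrow> (nat \<Rightarrow> 'a::banach) \<Rightarrow> bool" where
  "unconditional_basis K N e \<longleftrightarrow>
     1 \<le> K \<and> schauder_basis N e \<and>
     (\<forall>F a b. finite F \<longrightarrow> F \<subseteq> {n. enat n < N} \<longrightarrow> (\<forall>n\<in>F. \<bar>a n\<bar> \<le> \<bar>b n\<bar>) \<longrightarrow>
        norm (\<Sum>n\<in>F. a n *\<^sub>R e n) \<le> K * norm (\<Sum>n\<in>F. b n *\<^sub>R e n))"

definition uniformly_strongly_exposed :: "'a::banach set \<Rightarrow> bool" where
  "uniformly_strongly_exposed U \<longleftrightarrow>
     U \<subseteq> sphere 0 1 \<and>
     (\<exists>f :: 'a \<Rightarrow> ('a \<Rightarrow>\<^sub>L real).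
        (\<forall>u\<in>U. norm (f u) = 1 \<and> blinfun_apply (f u) u = 1) \<and>
        (\<forall>\<epsilon>>0. \<exists>\<delta>>0. \<forall>z\<in>cball 0 1. \<forall>u\<in>U.
           blinfun_apply (f u) z > 1 - \<delta> \<longrightarrow> norm (u - z) < \<epsilon>))"

text \<open>The uniform ball-covering property of the whole space \<open>'a\<close>. A pair \<open>(z, s) \<in> C\<close> stands for
  the open ball with centre \<open>z\<close> and radius \<open>s\<close>; \<open>C\<close> may be finite, and it may be empty, as it must
  be when \<open>'a\<close> is the zero space.\<close>

definition UBCP :: "'a::banach itself \<Rightarrow> bool" where
  "UBCP _ \<longleftrightarrow>
     (\<exists>r>0. \<exists>\<alpha>>0. \<exists>C :: ('a \<times> real) set.
        countable C \<and>
        sphere 0 1 \<subseteq> (\<Union>(z, s)\<in>C. ball z s) \<and>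
        (\<forall>(z, s)\<in>C. 0 < s \<and> s + \<alpha> \<le> norm z \<and> s \<le> r))"

end

theory Submission
  imports Defs
begin

text \<open>Case (1): let \<open>P\<^sub>n\<close> be the basis projections and let \<open>x\<close> be a norm-one functional.
  Unconditionality gives \<open>\<parallel>x - 2 (x \<circ> P\<^sub>n)\<parallel> = \<parallel>x \<circ> (I - 2 P\<^sub>n)\<parallel> \<le> K < 2\<close>, whereas
  \<open>\<parallel>2 (x \<circ> P\<^sub>n)\<parallel>\<close> is almost 2 for large \<open>n\<close>. As \<open>x \<circ> P\<^sub>n\<close> is a finite combination of coordinate
  functionals, countably many centres suffice.

  Case (2): if \<open>x u\<close> is close to 1 and \<open>t\<close> is large, then \<open>\<parallel>t f\<^sub>u - x\<parallel> \<le> t - 1/2\<close>: on the slice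
  where \<open>f\<^sub>u\<close> is close to 1, \<open>x\<close> is at least \<open>1/2\<close>, and off the slice \<open>t f\<^sub>u\<close> is below \<open>t - 3/2\<close>.
  A countable set that is only \<open>1/8\<close>-dense in \<open>U\<close> is enough.\<close>

section \<open>Norm bounds for functionals and countable nets\<close>

lemma norm_blinfun_le_cball:
  fixes g :: "'a::real_normed_vector \<Rightarrow>\<^sub>L real"
  assumes "\<And>z. norm z \<le> 1 \<Longrightarrow> g z \<le> b"
  shows "norm g \<le> b"
proof (rule norm_blinfun_bound)
  show "0 \<le> b"
    using assms[of 0] by simp
  fix x :: 'a
  show "norm (g x) \<le> b * norm x"
  proof (cases "x = 0")
    case False
    \<comment> \<open>The unit ball is symmetric, so a one-sided bound also controls the absolute
      value.\<close>
    then have "g (x /\<^sub>R norm x) \<le> b" "g (- (x /\<^sub>R norm x)) \<le> b"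
      by (auto intro!: assms)
    with False show ?thesis
      by (simp add: blinfun.minus_right blinfun.scaleR_right field_simps abs_le_iff)
  qed simp
qed

text \<open>A countable dense set may miss \<open>U\<close> altogether. Each of its points within
  \<epsilon>/2 of \<open>U\<close> is therefore replaced by a nearby point of \<open>U\<close>,
  which costs another \<epsilon>/2.\<close>

lemma separable_countable_net:
  fixes U :: "'a::metric_space set"
  assumes "separable_space (euclidean :: 'a topology)" and "0 < \<epsilon>"
  obtains V where "countable V" "V \<subseteq> U" "\<And>u. u \<in> U \<Longrightarrow> \<exists>v\<in>V. dist u v < \<epsilon>"
proof -
  obtain D :: "'a set" where D: "countable D" "closure D = UNIV"
    using assms(1) by (auto simp: separable_space_def)
  define D' where "D' = {d \<in> D. \<exists>u\<in>U. dist d u < \<epsilon>/2}"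
  have "\<forall>d\<in>D'. \<exists>u\<in>U. dist d u < \<epsilon>/2"
    by (auto simp: D'_def)
  then obtain p where p: "\<And>d. d \<in> D' \<Longrightarrow> p d \<in> U \<and> dist d (p d) < \<epsilon>/2"
    by metis
  show thesis
  proof
    show "countable (p ` D')"
      using D(1) by (auto simp: D'_def)
    show "p ` D' \<subseteq> U"
      using p by auto
    fix u assume "u \<in> U"
    have "u \<in> closure D"
      using D by simp
    then obtain d where d: "d \<in> D" "dist d u < \<epsilon>/2"
      using \<open>0 < \<epsilon>\<close> by (meson closure_approachable half_gt_zero)
    then have "d \<in> D'"
      using \<open>u \<in> U\<close> by (auto simp: D'_def)
    moreover have "dist u (p d) < \<epsilon>"
      using p[OF calculation] d(2) dist_triangle[of u "p d" d] by (simp add: dist_commute)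
    ultimately show "\<exists>v\<in>p ` D'. dist u v < \<epsilon>"
      by auto
  qed
qed

section \<open>Unconditional bases: bounded multipliers and coordinate functionals\<close>

lemma unconditional_basis_norm_le:
  fixes e :: "nat \<Rightarrow> 'a::banach"
  assumes "unconditional_basis K N e"
    and "\<And>n. N \<le> enat n \<Longrightarrow> a n = 0" "(\<lambda>n. a n *\<^sub>R e n) sums x"
    and "\<And>n. \<bar>c n\<bar> \<le> 1" "(\<lambda>n. (c n * a n) *\<^sub>R e n) sums y"
  shows "norm y \<le> K * norm x"
proof (rule LIMSEQ_le)
  show "(\<lambda>m. norm (\<Sum>n<m. (c n * a n) *\<^sub>R e n)) \<longlonglongrightarrow> norm y"
    using assms(5) by (auto simp: sums_def intro: tendsto_norm)
  show "(\<lambda>m. K * norm (\<Sum>n<m. a n *\<^sub>R e n)) \<longlonglongrightarrow> K * norm x"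
    using assms(3) by (auto simp: sums_def intro!: tendsto_intros)
  have "norm (\<Sum>n<m. (c n * a n) *\<^sub>R e n) \<le> K * norm (\<Sum>n<m. a n *\<^sub>R e n)" for m
  proof -
    let ?F = "{n\<in>{..<m}. enat n < N}"
    have "(\<Sum>n<m. (c n * a n) *\<^sub>R e n) = (\<Sum>n\<in>?F. (c n * a n) *\<^sub>R e n)"
      "(\<Sum>n<m. a n *\<^sub>R e n) = (\<Sum>n\<in>?F. a n *\<^sub>R e n)"
      using assms(2) by (force intro!: sum.mono_neutral_right)+
    moreover have "\<bar>c n * a n\<bar> \<le> \<bar>a n\<bar>" for n
      using assms(4)[of n] by (simp add: abs_mult mult_left_le_one_le)
    moreover have "finite ?F" "?F \<subseteq> {n. enat n < N}"
      by auto
    moreover have "norm (\<Sum>n\<in>F. a n *\<^sub>R e n) \<le> K * norm (\<Sum>n\<in>F. b n *\<^sub>R e n)"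
      if "finite F" "F \<subseteq> {n. enat n < N}" "\<And>n. \<bar>a n\<bar> \<le> \<bar>b n\<bar>" for F a b
      using assms(1) that unfolding unconditional_basis_def by blast
    ultimately show ?thesis
      by presburger
  qed
  then show "\<exists>M. \<forall>m\<ge>M. norm (\<Sum>n<m. (c n * a n) *\<^sub>R e n) \<le> K * norm (\<Sum>n<m. a n *\<^sub>R e n)"
    by blast
qed

text \<open>Uniqueness of expansions makes the coordinates linear. Their continuity comes from
  unconditionality itself, through the multiplier that keeps a single coordinate, so no open mapping
  argument is needed.\<close>

lemma unconditional_basis_coordinates:
  fixes e :: "nat \<Rightarrow> 'a::banach"
  assumes "unconditional_basis K N e"
  obtains g :: "nat \<Rightarrow> 'a \<Rightarrow>\<^sub>L real"
  where "\<And>x. (\<lambda>n. g n x *\<^sub>R e n) sums x"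
    and "\<And>n x. norm (x - 2 *\<^sub>R (\<Sum>k<n. g k x *\<^sub>R e k)) \<le> K * norm x"
proof -
  have basis: "\<exists>!a. (\<forall>n. N \<le> enat n \<longrightarrow> a n = 0) \<and> (\<lambda>n. a n *\<^sub>R e n) sums x" for x
    using assms unfolding unconditional_basis_def schauder_basis_def by blast
  then have "\<exists>a. \<forall>x. (\<forall>n. N \<le> enat n \<longrightarrow> a x n = 0) \<and> (\<lambda>n. a x n *\<^sub>R e n) sums x"
    by metis
  then obtain a where a0: "\<And>x n. N \<le> enat n \<Longrightarrow> a x n = 0"
    and a: "\<And>x. (\<lambda>n. a x n *\<^sub>R e n) sums x"
    by blast
  have a_unique: "b = a x"
    if "\<And>n. N \<le> enat n \<Longrightarrow> b n = 0" "(\<lambda>n. b n *\<^sub>R e n) sums x" for b x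
    using basis[of x] that a0 a by blast
  note le = unconditional_basis_norm_le[OF assms a0 a]
  \<comment> \<open>If \<open>e n\<close> were 0, its coefficient would be arbitrary, and 0 would
    have two expansions.\<close>
  have nz: "e n \<noteq> 0" if "enat n < N" for n
  proof
    assume "e n = 0"
    have "(\<lambda>k. of_bool (k = n)) = a 0"
      by (rule a_unique) (use that \<open>e n = 0\<close> in \<open>auto intro!: sums_0\<close>)
    moreover have "(\<lambda>k. 0) = a 0"
      by (rule a_unique) auto
    ultimately show False
      using fun_cong[of "\<lambda>k. of_bool (k = n)" "\<lambda>k. 0 :: real" n] by simp
  qed
  have bl: "bounded_linear (\<lambda>x. a x n)" for n
  proof (rule bounded_linear_intro)
    fix x y and r :: real
    have "(\<lambda>n. a x n + a y n) = a (x + y)"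
      by (rule a_unique) (auto simp: a0 scaleR_add_left intro!: sums_add a)
    then show "a (x + y) n = a x n + a y n"
      by metis
    have "(\<lambda>n. r * a x n) = a (r *\<^sub>R x)"
      by (rule a_unique) (auto simp: a0 simp flip: scaleR_scaleR intro!: sums_scaleR_right a)
    then show "a (r *\<^sub>R x) n = r *\<^sub>R a x n"
      by (metis real_scaleR_def)
    show "norm (a x n) \<le> norm x * (K / norm (e n))"
    proof (cases "enat n < N")
      case True
      have "norm (a x n *\<^sub>R e n) \<le> K * norm x"
      proof (rule le)
        show "(\<lambda>k. (of_bool (k = n) * a x k) *\<^sub>R e k) sums (a x n *\<^sub>R e n)"
          using sums_single[of n "\<lambda>k. a x k *\<^sub>R e k"]
          by (simp add: of_bool_def if_distrib if_distribR cong: if_cong)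
      qed auto
      then show ?thesis
        using nz[OF True] by (simp add: field_simps)
    qed (use assms in \<open>simp add: a0 unconditional_basis_def\<close>)
  qed
  show thesis
  proof
    show "(\<lambda>n. Blinfun (\<lambda>x. a x n) x *\<^sub>R e n) sums x" for x
      using a by (simp add: bounded_linear_Blinfun_apply[OF bl])
    fix n x
    have "norm (x - 2 *\<^sub>R (\<Sum>k<n. a x k *\<^sub>R e k)) \<le> K * norm x"
    proof (rule le)
      \<comment> \<open>The multiplier is -1 on the first \<open>n\<close> coordinates and 1
        afterwards. Subtracting a finitely supported series from the full expansion gives
        convergence for free.\<close>
      have "(\<lambda>k. a x k *\<^sub>R e k - 2 *\<^sub>R (if k \<in> {..<n} then a x k *\<^sub>R e k else 0)) sums
        (x - 2 *\<^sub>R (\<Sum>k<n. a x k *\<^sub>R e k))"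
        by (intro sums_diff a sums_scaleR_right sums_If_finite_set) auto
      moreover have "a x k *\<^sub>R e k - 2 *\<^sub>R (if k \<in> {..<n} then a x k *\<^sub>R e k else 0) =
        ((if k < n then - 1 else 1) * a x k) *\<^sub>R e k" for k
        by (simp add: scaleR_2)
      ultimately show "(\<lambda>k. ((if k < n then - 1 else 1) * a x k) *\<^sub>R e k) sums
        (x - 2 *\<^sub>R (\<Sum>k<n. a x k *\<^sub>R e k))"
        by (simp only:)
    qed auto
    then show "norm (x - 2 *\<^sub>R (\<Sum>k<n. Blinfun (\<lambda>x. a x k) x *\<^sub>R e k)) \<le> K * norm x"
      by (simp add: bounded_linear_Blinfun_apply[OF bl])
  qed
qed

section \<open>Countably many centres and a common radius\<close>

lemma rational_combination_approx:
  fixes g :: "nat \<Rightarrow> 'b::real_normed_vector"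
  assumes "0 < \<epsilon>"
  shows "\<exists>qs :: rat list.
    norm ((\<Sum>k<n. c k *\<^sub>R g k) - (\<Sum>k<length qs. of_rat (qs ! k) *\<^sub>R g k)) < \<epsilon>"
proof -
  \<comment> \<open>The added 1 avoids division by zero when \<open>g k\<close> is 0. Using
    \<open>Suc n\<close> in place of \<open>n\<close> makes the total error strictly smaller than
    \<epsilon>, also for \<open>n = 0\<close>.\<close>
  define \<delta> where "\<delta> k = \<epsilon> / (real (Suc n) * (norm (g k) + 1))" for k
  have "0 < \<delta> k" for k
    using assms by (simp add: \<delta>_def add_nonneg_pos)
  then have "\<exists>q. \<bar>c k - of_rat q\<bar> < \<delta> k" for k
    using of_rat_dense[of "c k - \<delta> k" "c k + \<delta> k"]
    by (metis abs_diff_less_iff diff_less_eq less_add_same_cancel1 order_less_trans)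
  then obtain q where q: "\<And>k. \<bar>c k - of_rat (q k)\<bar> < \<delta> k"
    by metis
  have "norm ((c k - of_rat (q k)) *\<^sub>R g k) \<le> \<epsilon> / real (Suc n)" for k
  proof -
    have "norm ((c k - of_rat (q k)) *\<^sub>R g k) \<le> \<delta> k * (norm (g k) + 1)"
      using q[of k] by (simp add: mult_mono)
    also have "\<dots> = \<epsilon> / real (Suc n)"
      using add_nonneg_pos[OF norm_ge_zero[of "g k"] zero_less_one] by (simp add: \<delta>_def)
    finally show ?thesis .
  qed
  then have "norm (\<Sum>k<n. (c k - of_rat (q k)) *\<^sub>R g k) \<le> real n * (\<epsilon> / real (Suc n))"
    using sum_norm_bound[of "{..<n}" "\<lambda>k. (c k - of_rat (q k)) *\<^sub>R g k" "\<epsilon> / real (Suc n)"]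
    by simp
  also have "\<dots> < \<epsilon>"
    using assms by (simp add: field_simps)
  finally show ?thesis
    by (intro exI[of _ "map q [0..<n]"]) (simp add: scaleR_diff_left sum_subtractf)
qed

text \<open>All balls get the same radius \<open>s\<close>. Only centres of large norm are kept, so
  \<open>Y\<close> may contain points too close to the origin, such as 0.\<close>

lemma UBCP_I:
  fixes Y :: "'b::banach set"
  assumes "countable Y" "0 < s" "0 < \<alpha>"
    and "\<And>x. norm x = 1 \<Longrightarrow> \<exists>y\<in>Y. dist y x < s \<and> s + \<alpha> \<le> norm y"
  shows "UBCP TYPE('b)"
  unfolding UBCP_def
proof (intro exI conjI)
  let ?C = "(\<lambda>y. (y, s)) ` {y\<in>Y. s + \<alpha> \<le> norm y}"
  show "countable ?C"
    using assms(1) by auto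
  show "sphere 0 1 \<subseteq> (\<Union>(z, s)\<in>?C. ball z s)"
    using assms(4) by fastforce
  show "\<forall>(z, s')\<in>?C. 0 < s' \<and> s' + \<alpha> \<le> norm z \<and> s' \<le> s"
    using assms(2) by auto
qed (use assms in auto)

section \<open>The case of an unconditional basis\<close>

lemma unconditional_basis_UBCP_dual:
  fixes e :: "nat \<Rightarrow> 'a::banach"
  assumes "unconditional_basis K N e" "K < 2"
  shows "UBCP TYPE('a \<Rightarrow>\<^sub>L real)"
proof -
  obtain g :: "nat \<Rightarrow> 'a \<Rightarrow>\<^sub>L real"
    where sums: "\<And>x. (\<lambda>n. g n x *\<^sub>R e n) sums x"
      and reflect: "\<And>n x. norm (x - 2 *\<^sub>R (\<Sum>k<n. g k x *\<^sub>R e k)) \<le> K * norm x"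
    using unconditional_basis_coordinates[OF assms(1)] by blast
  have "1 \<le> K"
    using assms(1) by (simp add: unconditional_basis_def)
  \<comment> \<open>Losing \<eta> in the norm of \<open>P n\<close> and \<eta> in the rational
    approximation leaves a centre of norm at least 2 - 4\<eta> = K + 4\<eta>. The radius K + 2\<eta>
    absorbs the doubled approximation error, and 2\<eta> remains as the gap.\<close>
  define \<eta> where "\<eta> = (2 - K) / 8"
  have "0 < \<eta>"
    using assms(2) by (simp add: \<eta>_def)
  define Y where "Y = range (\<lambda>qs. 2 *\<^sub>R (\<Sum>k<length qs. of_rat (qs ! k :: rat) *\<^sub>R g k))"
  show ?thesis
  proof (rule UBCP_I)
    show "countable Y"
      by (simp add: Y_def)
    show "0 < K + 2 * \<eta>" "0 < 2 * \<eta>"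
      using \<open>1 \<le> K\<close> \<open>0 < \<eta>\<close> by auto
    fix x :: "'a \<Rightarrow>\<^sub>L real" assume "norm x = 1"
    define P where "P n = (\<Sum>k<n. x (e k) *\<^sub>R g k)" for n
    have P: "P n z = x (\<Sum>k<n. g k z *\<^sub>R e k)" for n z
      by (simp add: P_def blinfun.sum_left blinfun.sum_right blinfun.scaleR_left
          blinfun.scaleR_right mult.commute)
    have "\<not> norm x \<le> 1 - \<eta>"
      using \<open>norm x = 1\<close> \<open>0 < \<eta>\<close> by simp
    then obtain z where z: "norm z \<le> 1" "1 - \<eta> < x z"
      using norm_blinfun_le_cball not_le by blast
    \<comment> \<open>Convergence at the single point \<open>z\<close> suffices to make
      \<open>norm (P n)\<close> large; \<open>P n\<close> need not converge to \<open>x\<close> in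
      norm.\<close>
    have "(\<lambda>n. P n z) \<longlonglongrightarrow> x z"
      using sums[of z] unfolding P sums_def by (rule blinfun.tendsto[OF tendsto_const])
    then obtain n where n: "1 - \<eta> < P n z"
      using z(2) by (metis order_tendstoD(1) eventually_sequentially order_refl)
    have "P n z \<le> norm (P n) * norm z"
      using norm_blinfun[of "P n" z] by simp
    also have "\<dots> \<le> norm (P n)"
      using z(1) by (simp add: mult_left_le)
    finally have norm_P: "1 - \<eta> < norm (P n)"
      using n by simp
    have dist_P: "norm (x - 2 *\<^sub>R P n) \<le> K"
    proof (rule norm_blinfun_le_cball)
      fix z :: 'a assume "norm z \<le> 1"
      have "(x - 2 *\<^sub>R P n) z = x (z - 2 *\<^sub>R (\<Sum>k<n. g k z *\<^sub>R e k))"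
        by (simp add: blinfun.diff_left blinfun.diff_right blinfun.scaleR_left
            blinfun.scaleR_right P)
      also have "\<dots> \<le> norm (z - 2 *\<^sub>R (\<Sum>k<n. g k z *\<^sub>R e k))"
        using norm_blinfun[of x "z - 2 *\<^sub>R (\<Sum>k<n. g k z *\<^sub>R e k)"] \<open>norm x = 1\<close> by simp
      also have "\<dots> \<le> K * norm z"
        by (rule reflect)
      also have "\<dots> \<le> K"
        using \<open>1 \<le> K\<close> \<open>norm z \<le> 1\<close> by (simp add: mult_left_le)
      finally show "(x - 2 *\<^sub>R P n) z \<le> K" .
    qed
    obtain qs :: "rat list"
      where qs: "norm (P n - (\<Sum>k<length qs. of_rat (qs ! k) *\<^sub>R g k)) < \<eta>"
      using rational_combination_approx[OF \<open>0 < \<eta>\<close>, of "\<lambda>k. x (e k)" g n]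
      unfolding P_def by blast
    define y where "y = (\<Sum>k<length qs. of_rat (qs ! k) *\<^sub>R g k)"
    have "2 *\<^sub>R y \<in> Y"
      by (auto simp: Y_def y_def)
    moreover have "dist (2 *\<^sub>R y) x < K + 2 * \<eta>"
    proof -
      have eq: "x - 2 *\<^sub>R y = (x - 2 *\<^sub>R P n) + 2 *\<^sub>R (P n - y)"
        by (simp add: algebra_simps)
      have "norm (x - 2 *\<^sub>R y) \<le> norm (x - 2 *\<^sub>R P n) + 2 * norm (P n - y)"
        unfolding eq by (rule order_trans[OF norm_triangle_ineq]) simp
      then show ?thesis
        using dist_P qs by (simp add: y_def dist_norm norm_minus_commute)
    qed
    moreover have "K + 2 * \<eta> + 2 * \<eta> \<le> norm (2 *\<^sub>R y)"
    proof -
      have "norm (P n) - norm y < \<eta>"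
        using norm_triangle_ineq2[of "P n" y] qs by (simp add: y_def)
      then show ?thesis
        using norm_P by (simp add: \<eta>_def field_simps)
    qed
    ultimately show "\<exists>y\<in>Y. dist y x < K + 2 * \<eta> \<and> K + 2 * \<eta> + 2 * \<eta> \<le> norm y"
      by blast
  qed
qed

section \<open>The case of uniformly strongly exposed points\<close>

lemma norm_blinfun_le_closure_convex_hull:
  fixes x :: "'a::real_normed_vector \<Rightarrow>\<^sub>L real"
  assumes "cball 0 1 = closure (convex hull U)" "\<And>u. u \<in> U \<Longrightarrow> x u \<le> b"
  shows "norm x \<le> b"
proof (rule norm_blinfun_le_cball)
  \<comment> \<open>A closed half-space containing \<open>U\<close> contains the closed convex hull
    of \<open>U\<close>, which is the unit ball.\<close>
  have "convex {z. x z \<le> b}"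
    unfolding convex_alt
  proof clarsimp
    fix y z and t :: real
    assume *: "x y \<le> b" "x z \<le> b" "0 \<le> t" "t \<le> 1"
    then have "(1 - t) * x y + t * x z \<le> b"
      by (intro convex_bound_le) auto
    then show "x ((1 - t) *\<^sub>R y + t *\<^sub>R z) \<le> b"
      by (simp add: blinfun.add_right blinfun.scaleR_right)
  qed
  moreover have "closed {z. x z \<le> b}"
    by (intro closed_Collect_le continuous_intros)
  ultimately have "closure (convex hull U) \<subseteq> {z. x z \<le> b}"
    using assms(2) by (intro closure_minimal hull_minimal) auto
  then show "x z \<le> b" if "norm z \<le> 1" for z
    using that unfolding assms(1)[symmetric] by auto
qed

lemma uniformly_strongly_exposed_UBCP_dual:
  fixes U :: "'a::banach set"
  assumes "separable_space (euclidean :: 'a topology)"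
    and "uniformly_strongly_exposed U" "cball 0 1 = closure (convex hull U)"
  shows "UBCP TYPE('a \<Rightarrow>\<^sub>L real)"
proof -
  obtain f :: "'a \<Rightarrow> ('a \<Rightarrow>\<^sub>L real)"
    where f: "\<And>u. u \<in> U \<Longrightarrow> norm (f u) = 1"
      and exposed: "\<forall>\<epsilon>>0. \<exists>\<delta>>0. \<forall>z\<in>cball 0 1. \<forall>u\<in>U.
        f u z > 1 - \<delta> \<longrightarrow> norm (u - z) < \<epsilon>"
    using assms(2) unfolding uniformly_strongly_exposed_def by blast
  \<comment> \<open>The constants fit together as follows: \<open>x u > 7/8\<close> at some point of
    \<open>U\<close>, hence \<open>x v > 3/4\<close> at a net point within 1/8, hence
    \<open>x z > 1/2\<close> within 1/4 of \<open>v\<close>.\<close>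
  obtain \<delta> where "0 < \<delta>"
    and \<delta>: "\<And>z u. norm z \<le> 1 \<Longrightarrow> u \<in> U \<Longrightarrow> 1 - \<delta> < f u z \<Longrightarrow> norm (u - z) < 1/4"
    using exposed[rule_format, of "1/4"] by auto
  obtain V where V: "countable V" "V \<subseteq> U" "\<And>u. u \<in> U \<Longrightarrow> \<exists>v\<in>V. dist u v < 1/8"
    using separable_countable_net[OF assms(1), of "1/8" U] by auto
  \<comment> \<open>Off the slice, \<open>t * f v z\<close> must drop by 3/2: up to 1 is lost to
    \<open>- x z\<close>, and 1/2 has to remain. The summand 1 keeps the radius positive however
    large \<delta> is.\<close>
  define t where "t = 1 + 3 / (2 * \<delta>)"
  have t: "1 < t" "3/2 \<le> t * \<delta>"
    using \<open>0 < \<delta>\<close> by (auto simp: t_def field_simps)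
  show ?thesis
  proof (rule UBCP_I)
    show "countable ((\<lambda>v. t *\<^sub>R f v) ` V)"
      using V(1) by simp
    \<comment> \<open>The radius lies midway between the distance bound \<open>t - 1/2\<close> and
      the norm \<open>t\<close> of the centre.\<close>
    show "0 < t - 1/4" "0 < (1/4 :: real)"
      using t by auto
    fix x :: "'a \<Rightarrow>\<^sub>L real" assume "norm x = 1"
    have le: "x z \<le> norm z" for z
      using norm_blinfun[of x z] \<open>norm x = 1\<close> by simp
    have "\<not> norm x \<le> 7/8"
      using \<open>norm x = 1\<close> by simp
    then obtain u where u: "u \<in> U" "7/8 < x u"
      using norm_blinfun_le_closure_convex_hull[OF assms(3)] not_le by blast
    then obtain v where v: "v \<in> V" "dist u v < 1/8"
      using V(3) by blast
    then have "3/4 < x v"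
      using le[of "u - v"] u by (simp add: blinfun.diff_right dist_norm)
    have "norm (t *\<^sub>R f v - x) \<le> t - 1/2"
    proof (rule norm_blinfun_le_cball)
      fix z :: 'a assume z: "norm z \<le> 1"
      have "f v z \<le> 1"
        using norm_blinfun[of "f v" z] z f[of v] v V(2) by auto
      have "t * f v z - x z \<le> t - 1/2"
      proof (cases "1 - \<delta> < f v z")
        case True
        then have "norm (v - z) < 1/4"
          using \<delta> z v V(2) by auto
        then have "1/2 < x z"
          using le[of "v - z"] \<open>3/4 < x v\<close> by (simp add: blinfun.diff_right)
        moreover have "t * f v z \<le> t"
          using \<open>f v z \<le> 1\<close> t by (simp add: mult_left_le)
        ultimately show ?thesis
          by simp
      next
        case False
        then have "t * f v z \<le> t * (1 - \<delta>)"
          using t by simp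
        then have "t * f v z \<le> t - 3/2"
          using t by (simp add: algebra_simps)
        moreover have "- x z \<le> 1"
          using le[of "- z"] z by (simp add: blinfun.minus_right)
        ultimately show ?thesis
          by simp
      qed
      then show "(t *\<^sub>R f v - x) z \<le> t - 1/2"
        by (simp add: blinfun.diff_left blinfun.scaleR_left)
    qed
    then have "dist (t *\<^sub>R f v) x < t - 1/4"
      by (simp add: dist_norm)
    moreover have "t - 1/4 + 1/4 \<le> norm (t *\<^sub>R f v)"
      using f[of v] v V(2) t by auto
    ultimately show "\<exists>y\<in>(\<lambda>v. t *\<^sub>R f v) ` V. dist y x < t - 1/4 \<and> t - 1/4 + 1/4 \<le> norm y"
      using v(1) by blast
  qed
qed

theorem theoremB:
  assumes "separable_space (euclidean :: 'a::banach topology)"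
    and "(\<exists>K N (e :: nat \<Rightarrow> 'a). K < 2 \<and> unconditional_basis K N e) \<or>
         (\<exists>U :: 'a set. uniformly_strongly_exposed U \<and> cball 0 1 = closure (convex hull U))"
  shows "UBCP TYPE('a \<Rightarrow>\<^sub>L real)"
  using assms unconditional_basis_UBCP_dual uniformly_strongly_exposed_UBCP_dual by blast

end
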